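(* Let $(R,M)$ be a finite chain ring with Loewy length $n$. Then, for every integer $k\ge 2$, $$\zeta_k(R)=\frac{\left|\left\{(a_1,\ldots,a_k)\in\{0,1,\ldots,n\}^k : a_1+\cdots+a_k\ge n\right\}\right|}{(n+1)^k}.$$
   Context: A finite chain ring $(R,M)$ is a finite (nonzero) commutative ring with identity whose ideals are linearly ordered by inclusion; $M$ denotes its unique maximal ideal. Its Loewy length is the smallest positive integer $n$ with $M^n=(0)$, so that $R=M^0\supsetneq M\supsetneq\cdots\supsetneq M^{n-1}\supsetneq M^n=(0)$. For a finite commutative ring $R$, let $\mathcal I(R)$ denote the set of all ideals of $R$. For an integer $k\ge 2$, the ideal zero-product probability is $$\zeta_k(R)=\frac{|\{(I_1,\ldots,I_k)\in\mathcal I(R)^k : I_1I_2\cdots I_k=(0)\}|}{|\mathcal I(R)|^k},$$ where $I_1\cdots I_k$ is the usual product of ideals. *)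

theory Defs
  imports Complex_Main "HOL-Library.FuncSet" "HOL-Algebra.Ideal_Product"
begin

text \<open>
  Ideals are handled through the library structure \<open>ideals_set R\<close>: its carrier is the set of all
  ideals of \<open>R\<close>, its multiplication is the product of ideals (finite sums of products) and its unit
  is the unit ideal \<open>carrier R\<close>. In particular the power of an ideal with exponent \<open>0\<close> is the
  whole ring.
\<close>

locale finite_chain_ring = cring R + maximalideal M R for R (structure) and M +
  assumes finite_carrier: "finite (carrier R)"
    and nonzero: "\<one> \<noteq> \<zero>"
    and ideals_linear: "\<lbrakk>ideal I R; ideal J R\<rbrakk> \<Longrightarrow> I \<subseteq> J \<or> J \<subseteq> I"

text \<open>The locale fixes \<open>M\<close> as a maximal ideal; that it is the only one follows from linearity.\<close>

lemma (in finite_chain_ring) maximalideal_unique: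
  assumes "maximalideal N R"
  shows "N = M"
proof -
  interpret N: maximalideal N R by fact
  have M: "ideal M R" and N: "ideal N R" by (rule is_ideal, rule N.is_ideal)
  from ideals_linear[OF M N] show ?thesis
  proof
    assume "M \<subseteq> N"
    with I_maximal[OF N] N.a_subset N.I_notcarr show ?thesis by auto
  next
    assume "N \<subseteq> M"
    with N.I_maximal[OF M] a_subset I_notcarr show ?thesis by auto
  qed
qed

text \<open>\<open>LEAST\<close> is meaningful here because \<open>M\<close> is nilpotent whenever \<open>R\<close> is a finite chain ring.\<close>

definition loewy_length :: "('a, 'b) ring_scheme \<Rightarrow> 'a set \<Rightarrow> nat" where
  "loewy_length R M = (LEAST n. 0 < n \<and> M [^]\<^bsub>ideals_set R\<^esub> n = {\<zero>\<^bsub>R\<^esub>})"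

text \<open>
  A \<open>k\<close>-tuple is an extensional function on \<open>{1..k}\<close>. For a commutative ring \<open>R\<close>, \<open>ideals_set R\<close>
  is a commutative monoid, so the finite product below is the product of all the listed ideals.
\<close>

definition ideal_zero_product_prob :: "('a, 'b) ring_scheme \<Rightarrow> nat \<Rightarrow> real" where
  "ideal_zero_product_prob R k =
     real (card {I \<in> {1..k} \<rightarrow>\<^sub>E carrier (ideals_set R).
                  (\<Otimes>\<^bsub>ideals_set R\<^esub> i\<in>{1..k}. I i) = {\<zero>\<^bsub>R\<^esub>}})
       / real (card (carrier (ideals_set R))) ^ k"

end

(* Since R is finite and its ideals form a chain, the maximal ideal is principal, M = (p), and
   every element outside M is a unit.  A coincidence p^i = p^j with i < j gives
   p^i (1 - p^(j-i)) = 0, so p is nilpotent.  If i is maximal with I contained in M^i, some element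
   of I is a unit multiple of p^i, so I = M^i.  Hence i |-> M^i is a bijection from {0..n} onto the
   ideals of R, it turns sums of exponents into products of ideals, and M^s = 0 iff s >= n. *)

theory Submission
  imports Defs
begin

section \<open>Powers in commutative monoids and products of principal ideals\<close>

lemma (in comm_monoid) finprod_nat_pow:
  fixes e :: "'i \<Rightarrow> nat"
  assumes "x \<in> carrier G"
  shows "(\<Otimes>i\<in>A. x [^] e i) = x [^] (\<Sum>i\<in>A. e i)"
proof (cases "finite A")
  case True
  then show ?thesis
    using assms by (induction A) (simp_all add: nat_pow_mult Pi_def)
next
  case False
  \<comment> \<open>Over an infinite \<open>A\<close> both defaults agree: the product is the unit,
    and the sum is 0, so the right side is \<open>x [^] 0\<close>.\<close>
  then show ?thesis
    by (simp add: finprod_infinite)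
qed

lemma carrier_ideals_set [simp]: "I \<in> carrier (ideals_set R) \<longleftrightarrow> ideal I R"
  and mult_ideals_set [simp]: "I \<otimes>\<^bsub>ideals_set R\<^esub> J = ideal_prod R I J"
  and one_ideals_set [simp]: "\<one>\<^bsub>ideals_set R\<^esub> = carrier R"
  by (simp_all add: ideals_set_def)

text \<open>Each generator of the product ideal has the form (x a)(y b) = (x y)(a b), and sums stay
  in \<open>PIdl (a \<otimes> b)\<close>. Conversely, \<open>a \<otimes> b\<close> is itself such a
  generator, so minimality of the principal ideal suffices.\<close>

lemma (in cring) ideal_prod_cgenideal:
  assumes a: "a \<in> carrier R" and b: "b \<in> carrier R"
  shows "(PIdl a) \<cdot> (PIdl b) = PIdl (a \<otimes> b)"
proof
  interpret ab: ideal "PIdl (a \<otimes> b)" R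
    using a b by (simp add: cgenideal_ideal)
  show "(PIdl a) \<cdot> (PIdl b) \<subseteq> PIdl (a \<otimes> b)"
  proof
    fix s assume "s \<in> (PIdl a) \<cdot> (PIdl b)"
    then show "s \<in> PIdl (a \<otimes> b)"
    proof (induction s rule: ideal_prod.induct)
      case (prod i j)
      then obtain x y where "x \<in> carrier R" "i = x \<otimes> a" "y \<in> carrier R" "j = y \<otimes> b"
        unfolding cgenideal_def by blast
      then have "i \<otimes> j = (x \<otimes> y) \<otimes> (a \<otimes> b)" "x \<otimes> y \<in> carrier R"
        using a b by (simp_all add: m_ac)
      then show ?case unfolding cgenideal_def by blast
    next
      case (sum s t)
      then show ?case by simp
    qed
  qed
  show "PIdl (a \<otimes> b) \<subseteq> (PIdl a) \<cdot> (PIdl b)"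
    using a b by (intro cgenideal_minimal ideal_prod_is_ideal cgenideal_ideal ideal_prod.prod
        cgenideal_self) auto
qed

lemma (in cring) ideals_set_pow_cgenideal:
  assumes "a \<in> carrier R"
  shows "(PIdl a) [^]\<^bsub>ideals_set R\<^esub> (i::nat) = PIdl (a [^] i)"
proof (induction i)
  case 0
  have "PIdl \<one> = carrier R"
    by (simp add: cgenideal_eq_genideal genideal_one)
  then show ?case by simp
next
  case (Suc i)
  then show ?case using assms by (simp add: ideal_prod_cgenideal)
qed

section \<open>Units, principal ideals and nilpotency in a finite chain ring\<close>

context finite_chain_ring
begin

sublocale ideals: comm_monoid "ideals_set R"
  by (rule ideals_set_is_comm_monoid)

text \<open>By linearity the ideal \<open>PIdl r\<close>, not being inside \<open>M\<close>,
  contains \<open>M\<close>; maximality then makes it the whole ring, so \<open>\<one>\<close> is a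
  multiple of \<open>r\<close>.\<close>

lemma unit_if_not_mem_maximal:
  assumes r: "r \<in> carrier R" "r \<notin> M"
  shows "r \<in> Units R"
proof -
  have I: "ideal (PIdl r) R" using r by (simp add: cgenideal_ideal)
  have "r \<in> PIdl r" using r by (simp add: cgenideal_self)
  then have "\<not> PIdl r \<subseteq> M" using r by blast
  then have "M \<subseteq> PIdl r" using ideals_linear[OF I is_ideal] by blast
  moreover have "PIdl r \<subseteq> carrier R" using ideal.Icarr[OF I] by blast
  ultimately have "PIdl r = carrier R"
    using I_maximal[OF I] \<open>\<not> PIdl r \<subseteq> M\<close> by blast
  then obtain x where "x \<in> carrier R" "\<one> = x \<otimes> r"
    using one_closed unfolding cgenideal_def by blast
  then show ?thesis
    using r m_comm[of x r] unfolding Units_def by auto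
qed

text \<open>A generator is any element of \<open>I\<close> whose principal ideal has the most
  elements: principal ideals are comparable, so this largest one contains \<open>PIdl x\<close> for
  every \<open>x\<close> in \<open>I\<close>.\<close>

lemma principal_ideal:
  assumes I: "ideal I R"
  obtains p where "p \<in> carrier R" "I = PIdl p"
proof -
  interpret I: ideal I R by fact
  have fin: "finite (PIdl x)" if "x \<in> carrier R" for x
    using finite_subset[OF _ finite_carrier] ideal.Icarr[OF cgenideal_ideal[OF that]] by blast
  have "finite I"
    using finite_subset[OF I.a_subset finite_carrier] .
  moreover have "I \<noteq> {}" using I.zero_closed by blast
  ultimately obtain p where p: "p \<in> I"
    and pmax: "\<And>x. x \<in> I \<Longrightarrow> card (PIdl x) \<le> card (PIdl p)"
    using obtains_MAX[of I "\<lambda>x. card (PIdl x)"] by (metis Max_ge finite_imageI imageI)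
  have pc: "p \<in> carrier R" using p I.Icarr by blast
  have "x \<in> PIdl p" if x: "x \<in> I" for x
  proof -
    have xc: "x \<in> carrier R" using x I.Icarr by blast
    have "PIdl x \<subseteq> PIdl p"
      using ideals_linear[OF cgenideal_ideal[OF xc] cgenideal_ideal[OF pc]]
        card_seteq[OF fin[OF xc] _ pmax[OF x]] by blast
    then show ?thesis using cgenideal_self[OF xc] by blast
  qed
  then have "I = PIdl p"
    using cgenideal_minimal[OF I p] by blast
  then show thesis using pc that by blast
qed

lemma nilpotent_if_mem_maximal:
  assumes p: "p \<in> M"
  obtains i :: nat where "p [^] i = \<zero>"
proof -
  have pc: "p \<in> carrier R" using p Icarr by blast
  have "range (\<lambda>i::nat. p [^] i) \<subseteq> carrier R" using pc by auto
  then have "\<not> inj (\<lambda>i::nat. p [^] i)"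
    using finite_carrier finite_imageD finite_subset infinite_UNIV_nat by blast
  then obtain i j :: nat where ij: "i < j" "p [^] i = p [^] j"
    unfolding inj_def by (metis nat_neq_iff)
  define q where "q = p [^] (j - i)"
  have qc: "q \<in> carrier R" using pc by (simp add: q_def)
  \<comment> \<open>Since \<open>i < j\<close>, the exponent is a successor; this exhibits a factor
    \<open>p\<close> and places \<open>q\<close> in \<open>M\<close>.\<close>
  have "q = p [^] Suc (j - i - 1)"
    using ij(1) by (simp only: q_def) (metis Suc_diff_1 zero_less_diff)
  then have qM: "q \<in> M" using p pc by (simp add: I_l_closed)
  have "\<one> \<ominus> q \<notin> M"
  proof
    assume "\<one> \<ominus> q \<in> M"
    then have "(\<one> \<ominus> q) \<oplus> q \<in> M" using qM by simp
    then have "\<one> \<in> M" using qc by (simp add: a_minus_def a_assoc l_neg)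
    then show False using one_imp_carrier I_notcarr by blast
  qed
  then have u: "\<one> \<ominus> q \<in> Units R" using qc by (simp add: unit_if_not_mem_maximal)
  have "p [^] i \<otimes> q = p [^] i"
    using nat_pow_mult[OF pc, of i "j - i"] ij by (simp add: q_def)
  then have "p [^] i \<otimes> (\<one> \<ominus> q) = \<zero>"
    using pc qc by (simp add: a_minus_def r_distr r_minus r_neg)
  then have "(\<one> \<ominus> q) \<otimes> p [^] i = (\<one> \<ominus> q) \<otimes> \<zero>"
    using pc qc by (simp add: m_comm)
  then have "p [^] i = \<zero>"
    using Units_l_cancel[OF u, of "p [^] i" \<zero>] pc by blast
  then show thesis using that by blast
qed

section \<open>Powers of the maximal ideal\<close>

lemma ideal_maximal_pow [simp]: "ideal (M [^]\<^bsub>ideals_set R\<^esub> (i::nat)) R"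
  using ideals.nat_pow_closed[of M i] is_ideal by simp

text \<open>Shows that the \<open>LEAST\<close> in \<open>loewy_length\<close> is attained: a
  generator of \<open>M\<close> is nilpotent, and the exponent that kills it is positive because
  \<open>\<one> \<noteq> \<zero>\<close>.\<close>

lemma maximal_pow_loewy_length:
  "M [^]\<^bsub>ideals_set R\<^esub> loewy_length R M = {\<zero>}"
proof -
  obtain p where p: "p \<in> carrier R" "M = PIdl p"
    using principal_ideal[OF is_ideal] .
  then have "p \<in> M" by (simp add: cgenideal_self)
  then obtain i :: nat where i: "p [^] i = \<zero>" by (rule nilpotent_if_mem_maximal)
  then have "i \<noteq> 0" using nonzero by (cases i) auto
  moreover have "M [^]\<^bsub>ideals_set R\<^esub> i = {\<zero>}"
    unfolding p(2) ideals_set_pow_cgenideal[OF p(1)] i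
    by (simp add: cgenideal_eq_genideal genideal_zero)
  ultimately have "0 < i \<and> M [^]\<^bsub>ideals_set R\<^esub> i = {\<zero>}" by simp
  from LeastI[of "\<lambda>n. 0 < n \<and> M [^]\<^bsub>ideals_set R\<^esub> n = {\<zero>}", OF this]
  show ?thesis
    unfolding loewy_length_def by blast
qed

text \<open>One direction is minimality of the Loewy length, once exponent 0, which gives the
  nonzero whole ring, is excluded. For the other, a higher power has the zero ideal as a
  factor.\<close>

lemma maximal_pow_eq_zero_iff:
  "M [^]\<^bsub>ideals_set R\<^esub> (i::nat) = {\<zero>} \<longleftrightarrow> loewy_length R M \<le> i"
proof
  assume i: "M [^]\<^bsub>ideals_set R\<^esub> i = {\<zero>}"
  have "i \<noteq> 0"
  proof
    assume "i = 0"
    with i have "carrier R = {\<zero>}" by simp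
    then show False using nonzero one_closed by blast
  qed
  with i show "loewy_length R M \<le> i"
    unfolding loewy_length_def by (intro Least_le) simp
next
  let ?n = "loewy_length R M"
  assume "?n \<le> i"
  then have "M [^]\<^bsub>ideals_set R\<^esub> i =
      ideal_prod R (M [^]\<^bsub>ideals_set R\<^esub> (i - ?n)) (M [^]\<^bsub>ideals_set R\<^esub> ?n)"
    using ideals.nat_pow_mult[of M "i - ?n" ?n] is_ideal by simp
  then show "M [^]\<^bsub>ideals_set R\<^esub> i = {\<zero>}"
    by (simp only: maximal_pow_loewy_length ideal_prod_zero ideal_maximal_pow)
qed

lemma ideal_eq_maximal_pow:
  assumes I: "ideal I R"
  obtains i where "i \<le> loewy_length R M" "I = M [^]\<^bsub>ideals_set R\<^esub> i"
\<comment> \<open>The zero ideal lies in every power of \<open>M\<close>, so no greatest exponent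
  exists for it and it is treated apart.\<close>
proof (cases "I = {\<zero>}")
  case True
  then show thesis using that[of "loewy_length R M"] maximal_pow_loewy_length by blast
next
  case False
  interpret I: ideal I R by fact
  obtain p where p: "p \<in> carrier R" "M = PIdl p"
    using principal_ideal[OF is_ideal] .
  have pow: "M [^]\<^bsub>ideals_set R\<^esub> i = PIdl (p [^] i)" for i :: nat
    unfolding p(2) by (rule ideals_set_pow_cgenideal[OF p(1)])
  define P where "P = (\<lambda>i::nat. I \<subseteq> M [^]\<^bsub>ideals_set R\<^esub> i)"
  have "P 0" by (simp add: P_def I.a_subset)
  \<comment> \<open>Beyond the Loewy length the powers vanish and cannot contain the nonzero
    \<open>I\<close>. This bound makes \<open>Greatest P\<close> meaningful.\<close>
  have bound: "i \<le> loewy_length R M" if "P i" for i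
  proof (rule ccontr)
    assume "\<not> i \<le> loewy_length R M"
    then have "I \<subseteq> {\<zero>}" using that maximal_pow_eq_zero_iff[of i] by (simp add: P_def)
    then show False using False I.zero_closed by blast
  qed
  define i where "i = Greatest P"
  have Pi: "P i"
    unfolding i_def using \<open>P 0\<close> bound by (rule GreatestI_nat)
  have "\<not> P (Suc i)"
    using Greatest_le_nat[of P "Suc i", OF _ bound] unfolding i_def by (meson Suc_n_not_le_n)
  then obtain x where x: "x \<in> I" "x \<notin> M [^]\<^bsub>ideals_set R\<^esub> Suc i"
    unfolding P_def by blast
  then have "x \<in> PIdl (p [^] i)" using Pi unfolding P_def pow by blast
  then obtain r where r: "r \<in> carrier R" "x = r \<otimes> p [^] i" unfolding cgenideal_def by blast
  \<comment> \<open>Otherwise \<open>r\<close> would contribute one more factor \<open>p\<close>,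
    and \<open>x\<close> would lie in the next power, contrary to its choice.\<close>
  have "r \<notin> M"
  proof
    assume "r \<in> M"
    then obtain s where s: "s \<in> carrier R" "r = s \<otimes> p" using p(2) unfolding cgenideal_def by blast
    then have "x = s \<otimes> p [^] Suc i" using r p by (simp add: m_ac)
    then have "x \<in> PIdl (p [^] Suc i)" unfolding cgenideal_def using s by blast
    then show False using x(2) unfolding pow by blast
  qed
  then have u: "r \<in> Units R" using r unit_if_not_mem_maximal by blast
  then have "p [^] i = inv r \<otimes> x"
    using r p(1) by (simp add: m_assoc[symmetric])
  then have "p [^] i \<in> I" using x u by (simp add: I.I_l_closed)
  then have "PIdl (p [^] i) \<subseteq> I" by (rule cgenideal_minimal[OF I])
  then have "I = M [^]\<^bsub>ideals_set R\<^esub> i" using Pi unfolding P_def pow by blast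
  then show thesis using that bound[OF Pi] by blast
qed

text \<open>If two powers with exponents \<open>i < j\<close> agreed, multiplying both by the power
  with exponent \<open>loewy_length R M - j\<close> would make them zero, although the exponent on
  the side of \<open>i\<close> stays below the Loewy length.\<close>

lemma inj_on_maximal_pow: "inj_on (\<lambda>i::nat. M [^]\<^bsub>ideals_set R\<^esub> i) {0..loewy_length R M}"
proof (rule linorder_inj_onI)
  fix i j :: nat
  assume ij: "i < j" "j \<in> {0..loewy_length R M}"
  show "M [^]\<^bsub>ideals_set R\<^esub> i \<noteq> M [^]\<^bsub>ideals_set R\<^esub> j"
  proof
    let ?d = "loewy_length R M - j"
    assume eq: "M [^]\<^bsub>ideals_set R\<^esub> i = M [^]\<^bsub>ideals_set R\<^esub> j"
    have "M [^]\<^bsub>ideals_set R\<^esub> (i + ?d) = M [^]\<^bsub>ideals_set R\<^esub> (j + ?d)"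
      using ideals.nat_pow_mult[of M i ?d] ideals.nat_pow_mult[of M j ?d] is_ideal eq by simp
    then have "M [^]\<^bsub>ideals_set R\<^esub> (i + ?d) = {\<zero>}"
      using ij by (simp add: maximal_pow_loewy_length)
    then have "loewy_length R M \<le> i + ?d" by (simp only: maximal_pow_eq_zero_iff)
    then show False using ij by simp
  qed
qed auto

lemma bij_betw_maximal_pow:
  "bij_betw (\<lambda>i::nat. M [^]\<^bsub>ideals_set R\<^esub> i) {0..loewy_length R M} (carrier (ideals_set R))"
proof -
  have "carrier (ideals_set R) \<subseteq> (\<lambda>i::nat. M [^]\<^bsub>ideals_set R\<^esub> i) ` {0..loewy_length R M}"
  proof
    fix I assume "I \<in> carrier (ideals_set R)"
    then have "ideal I R" by simp
    then obtain i where "i \<le> loewy_length R M" "I = M [^]\<^bsub>ideals_set R\<^esub> i"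
      by (rule ideal_eq_maximal_pow)
    then show "I \<in> (\<lambda>i::nat. M [^]\<^bsub>ideals_set R\<^esub> i) ` {0..loewy_length R M}" by auto
  qed
  then show ?thesis
    using inj_on_maximal_pow by (auto simp: bij_betw_def)
qed

end

section \<open>Counting tuples of ideals by tuples of exponents\<close>

lemma card_PiE_reindex:
  assumes f: "bij_betw f B C"
    and PQ: "\<And>a. a \<in> A \<rightarrow>\<^sub>E B \<Longrightarrow> Q (\<lambda>i\<in>A. f (a i)) \<longleftrightarrow> P a"
  shows "card {c \<in> A \<rightarrow>\<^sub>E C. Q c} = card {a \<in> A \<rightarrow>\<^sub>E B. P a}"
proof -
  let ?g = "the_inv_into B f"
  \<comment> \<open>Restriction to \<open>A\<close> keeps the tuples extensional, so
    \<open>?F\<close> and \<open>?G\<close> are inverse to each other as maps of whole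
    functions.\<close>
  let ?F = "\<lambda>a. \<lambda>i\<in>A. f (a i)" and ?G = "\<lambda>c. \<lambda>i\<in>A. ?g (c i)"
  note inj = bij_betw_imp_inj_on[OF f]
  have fB: "f b \<in> C" "?g (f b) = b" if "b \<in> B" for b
    using that bij_betw_apply[OF f] the_inv_into_f_f[OF inj] by auto
  have gC: "?g c \<in> B" "f (?g c) = c" if "c \<in> C" for c
    using that bij_betw_apply[OF bij_betw_the_inv_into[OF f]] f_the_inv_into_f_bij_betw[OF f]
    by auto
  have F: "?F a \<in> A \<rightarrow>\<^sub>E C" "?G (?F a) = a" if "a \<in> A \<rightarrow>\<^sub>E B" for a
    using that fB by (auto intro!: extensionalityI[of _ A] simp: PiE_def Pi_def)
  have G: "?G c \<in> A \<rightarrow>\<^sub>E B" "?F (?G c) = c" if "c \<in> A \<rightarrow>\<^sub>E C" for c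
    using that gC by (auto intro!: extensionalityI[of _ A] simp: PiE_def Pi_def)
  have "bij_betw ?F {a \<in> A \<rightarrow>\<^sub>E B. P a} {c \<in> A \<rightarrow>\<^sub>E C. Q c}"
  proof (rule bij_betw_byWitness[where f' = ?G])
    show "\<forall>a\<in>{a \<in> A \<rightarrow>\<^sub>E B. P a}. ?G (?F a) = a"
      using F(2) by blast
    show "\<forall>c\<in>{c \<in> A \<rightarrow>\<^sub>E C. Q c}. ?F (?G c) = c"
      using G(2) by blast
    show "?F ` {a \<in> A \<rightarrow>\<^sub>E B. P a} \<subseteq> {c \<in> A \<rightarrow>\<^sub>E C. Q c}"
      using F(1) PQ by blast
    show "?G ` {c \<in> A \<rightarrow>\<^sub>E C. Q c} \<subseteq> {a \<in> A \<rightarrow>\<^sub>E B. P a}"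
    proof clarify
      fix c assume c: "c \<in> A \<rightarrow>\<^sub>E C" "Q c"
      then show "?G c \<in> A \<rightarrow>\<^sub>E B \<and> P (?G c)"
        \<comment> \<open>\<open>PQ\<close> speaks only of tuples in the image of \<open>?F\<close>,
          so \<open>c\<close> is first rewritten as \<open>?F (?G c)\<close>.\<close>
        using G[OF c(1)] PQ[OF G(1)[OF c(1)]] by argo
    qed
  qed
  then show ?thesis by (rule bij_betw_same_card[symmetric])
qed

theorem theorem4p6:
  fixes R (structure) and M :: "'a set" and n k :: nat
  assumes "finite_chain_ring R M"
    and "n = loewy_length R M"
    and "2 \<le> k"
  shows "ideal_zero_product_prob R k =
           real (card {a \<in> {1..k} \<rightarrow>\<^sub>E {0..n}. n \<le> (\<Sum>i\<in>{1..k}. a i)}) / real (n + 1) ^ k"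
proof -
  interpret finite_chain_ring R M by fact
  let ?f = "\<lambda>i::nat. M [^]\<^bsub>ideals_set R\<^esub> i"
  have bij: "bij_betw ?f {0..n} (carrier (ideals_set R))"
    unfolding assms(2) by (rule bij_betw_maximal_pow)
  have "card {I \<in> {1..k} \<rightarrow>\<^sub>E carrier (ideals_set R). (\<Otimes>\<^bsub>ideals_set R\<^esub> i\<in>{1..k}. I i) = {\<zero>}}
      = card {a \<in> {1..k} \<rightarrow>\<^sub>E {0..n}. n \<le> (\<Sum>i\<in>{1..k}. a i)}"
  proof (rule card_PiE_reindex[OF bij])
    fix a :: "nat \<Rightarrow> nat"
    have "(\<Otimes>\<^bsub>ideals_set R\<^esub> i\<in>{1..k}. (\<lambda>i\<in>{1..k}. ?f (a i)) i) =
        (\<Otimes>\<^bsub>ideals_set R\<^esub> i\<in>{1..k}. ?f (a i))"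
      by (rule ideals.finprod_cong') auto
    also have "\<dots> = ?f (\<Sum>i\<in>{1..k}. a i)"
      using is_ideal by (intro ideals.finprod_nat_pow) simp
    finally show "(\<Otimes>\<^bsub>ideals_set R\<^esub> i\<in>{1..k}. (\<lambda>i\<in>{1..k}. ?f (a i)) i) = {\<zero>} \<longleftrightarrow>
        n \<le> (\<Sum>i\<in>{1..k}. a i)"
      by (simp only: maximal_pow_eq_zero_iff assms(2))
  qed
  \<comment> \<open>The exponents run from 0, the whole ring, to \<open>n\<close>, the zero ideal,
    both included.\<close>
  moreover have "card (carrier (ideals_set R)) = n + 1"
    using bij_betw_same_card[OF bij] by simp
  ultimately show ?thesis
    by (simp only: ideal_zero_product_prob_def)
qed

end
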